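(* Let $G=(V,E)$ be a simple finite graph on $m$ vertices $\{v_1,\ldots,v_m\}$ and suppose that for some positive integer $d$ the graph has a unique vertex $v_k$ of degree $d$. Then the zeon combinatorial Laplacian $\Lambda=\Delta-\Psi$ of $G$ has a spectrally simple eigenvalue $\lambda$ satisfying $$\lambda = d+\sum_{I\subseteq[m]}\omega_I\,\zeta_I\prod_{j\in I\setminus\{k\}}\bigl(d-\deg(v_j)\bigr)^{-1},$$ where $(-1)^{|I|}\omega_I$ is the number of cycles based at $v_k$ on vertices indexed by $I$.
   Context: Zeon algebra: $\mathbb{C}\mathfrak{Z}$ is the commutative unital complex algebra generated by $\zeta_{\{i\}}$, $i\in\mathbb{N}=\{1,2,\ldots\}$, and the scalar $1=\zeta_\varnothing$, with $\zeta_{\{i\}}\zeta_{\{j\}}=\zeta_{\{j\}}\zeta_{\{i\}}=\zeta_{\{i,j\}}$ for $i\neq j$ and $\zeta_{\{i\}}^2=0$. For finite $I\subset\mathbb{N}$, $\zeta_I=\prod_{i\in I}\zeta_{\{i\}}$; the $\zeta_I$ form a vector space basis, and $\zeta_I\zeta_J=\zeta_{I\cup J}$ if $I\cap J=\varnothing$, and $0$ otherwise. For $u=\sum_I u_I\zeta_I$ (finite sum, $u_I\in\mathbb{C}$), the scalar part is $\mathfrak{C}u=u_\varnothing$. For a matrix $A$ over $\mathbb{C}\mathfrak{Z}$, $\mathfrak{C}A$ is the complex matrix of scalar parts of the entries. Eigenvalues: for $A\in\mathrm{Mat}(m,\mathbb{C}\mathfrak{Z})$, $\lambda\in\mathbb{C}\mathfrak{Z}$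 is an eigenvalue if $A\xi=\lambda\xi$ for some non-null $\xi\in\mathbb{C}\mathfrak{Z}^m$ (non-null: $\mathfrak{C}(\overline{\xi}^{\intercal}\xi)\ne 0$, where the bar is complex conjugation of coefficients; equivalently some component of $\xi$ has nonzero scalar part). The characteristic polynomial is $\chi_A(t)=\det(t\mathbb{I}-A)$. An eigenvalue $\lambda$ is spectrally simple if it is a simple zero of $\chi_A$ (i.e. $\chi_A(u)=(u-\lambda)g(u)$ with $g(\lambda)\neq 0$ for a polynomial $g$ over $\mathbb{C}\mathfrak{Z}$) and $\mathfrak{C}\lambda$ is a simple zero of the complex polynomial obtained by taking scalar parts of the coefficients of $\chi_A$. Graphs: $[m]=\{1,\ldots,m\}$. The nilpotent adjacency matrix $\Psi=(\psi_{ij})$ of $G$ has $\psi_{ij}=\zeta_{\{j\}}$ if $\{v_i,v_j\}\in E$ and $\psi_{ij}=0$ otherwise. $\Delta=\mathrm{diag}(\deg v_1,\ldots,\deg v_m)$. The zeon combinatorial Laplacian is $\Lambda=\Delta-\Psi$. Cycles: a $k$-cycle based at $v$ is a sequence of vertices $(w_0,w_1,\ldots,w_k)$ with $w_0=w_k=v$, consecutive vertices adjacent, and $w_0,\ldots,w_{k-1}$ distinct. Cycles are counted as sequences, so 2-cycles $(v,w,v)$ along an edge are counted and the two orientations of a longer cycle are counted separately. The cycle is on vertices indexed by $I$ if $\{w_0,\ldots,w_{k-1}\}=\{v_i:i\in I\}$. *)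

theory Defs
  imports Complex_Main "Jordan_Normal_Form.Char_Poly"
begin

section \<open>The zeon algebra\<close>

text \<open>An element is represented by its coefficient family \<open>(u\<^sub>I)\<close> over the finite sets
  \<open>I\<close> of positive integers, of which only finitely many are nonzero.\<close>

typedef zeon =
  "{f :: nat set \<Rightarrow> complex. finite {I. f I \<noteq> 0} \<and> (\<forall>I. f I \<noteq> 0 \<longrightarrow> finite I \<and> 0 \<notin> I)}"
  morphisms zeon_coeff Abs_zeon
  by (rule exI[of _ "\<lambda>_. 0"]) auto

setup_lifting type_definition_zeon

lemma zeon_eqI: "(\<And>I. zeon_coeff u I = zeon_coeff v I) \<Longrightarrow> u = v"
  by (metis ext zeon_coeff_inject)

lemma finite_zeon_support: "finite {I. zeon_coeff u I \<noteq> 0}"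
  using zeon_coeff[of u] by auto

lemma zeon_support: "zeon_coeff u I \<noteq> 0 \<Longrightarrow> finite I \<and> 0 \<notin> I"
  using zeon_coeff[of u] by auto

lift_definition zeta :: "nat set \<Rightarrow> zeon" is
  "\<lambda>I J. if J = I \<and> finite I \<and> 0 \<notin> I then 1 else 0"
  by auto

lift_definition scalar_part :: "zeon \<Rightarrow> complex" is "\<lambda>f. f {}" .

lift_definition zeon_scale :: "complex \<Rightarrow> zeon \<Rightarrow> zeon" (infixr "*\<^sub>Z" 75) is
  "\<lambda>c f I. c * f I"
  by (auto elim: rev_finite_subset)

lift_definition zeon_cnj :: "zeon \<Rightarrow> zeon" is "\<lambda>f I. cnj (f I)"
  by auto

instantiation zeon :: comm_ring_1
begin

lift_definition zero_zeon :: zeon is "\<lambda>_. 0"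
  by auto

definition one_zeon :: zeon where "one_zeon = zeta {}"

lift_definition plus_zeon :: "zeon \<Rightarrow> zeon \<Rightarrow> zeon" is "\<lambda>f g I. f I + g I"
proof -
  fix f g :: "nat set \<Rightarrow> complex"
  assume f: "finite {I. f I \<noteq> 0} \<and> (\<forall>I. f I \<noteq> 0 \<longrightarrow> finite I \<and> 0 \<notin> I)"
    and g: "finite {I. g I \<noteq> 0} \<and> (\<forall>I. g I \<noteq> 0 \<longrightarrow> finite I \<and> 0 \<notin> I)"
  have "{I. f I + g I \<noteq> 0} \<subseteq> {I. f I \<noteq> 0} \<union> {I. g I \<noteq> 0}"
    by auto
  with f g have "finite {I. f I + g I \<noteq> 0}"
    by (meson finite_UnI finite_subset)
  moreover have "f I \<noteq> 0 \<or> g I \<noteq> 0" if "f I + g I \<noteq> 0" for I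
    using that by auto
  ultimately show "finite {I. f I + g I \<noteq> 0} \<and>
      (\<forall>I. f I + g I \<noteq> 0 \<longrightarrow> finite I \<and> 0 \<notin> I)"
    using f g by blast
qed

lift_definition uminus_zeon :: "zeon \<Rightarrow> zeon" is "\<lambda>f I. - f I"
  by auto

definition minus_zeon :: "zeon \<Rightarrow> zeon \<Rightarrow> zeon" where "minus_zeon u v = u + - v"

text \<open>The bilinear extension of \<open>\<zeta>\<^sub>I \<zeta>\<^sub>J = \<zeta>\<^bsub>I \<union> J\<^esub>\<close> for disjoint \<open>I\<close>, \<open>J\<close>, and \<open>0\<close>
  otherwise; see \<open>zeta_mult\<close>.\<close>

lift_definition times_zeon :: "zeon \<Rightarrow> zeon \<Rightarrow> zeon" is
  "\<lambda>f g K. \<Sum>I\<in>Pow K. f I * g (K - I)"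
proof -
  fix f g :: "nat set \<Rightarrow> complex"
  assume f: "finite {I. f I \<noteq> 0} \<and> (\<forall>I. f I \<noteq> 0 \<longrightarrow> finite I \<and> 0 \<notin> I)"
    and g: "finite {I. g I \<noteq> 0} \<and> (\<forall>I. g I \<noteq> 0 \<longrightarrow> finite I \<and> 0 \<notin> I)"
  have *: "\<exists>I J. f I \<noteq> 0 \<and> g J \<noteq> 0 \<and> K = I \<union> J"
    if nz: "(\<Sum>I\<in>Pow K. f I * g (K - I)) \<noteq> 0" for K
  proof -
    obtain I where "I \<in> Pow K" "f I * g (K - I) \<noteq> 0"
      using nz by (rule sum.not_neutral_contains_not_neutral)
    then have "f I \<noteq> 0 \<and> g (K - I) \<noteq> 0 \<and> K = I \<union> (K - I)" by auto
    then show ?thesis by blast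
  qed
  then have "{K. (\<Sum>I\<in>Pow K. f I * g (K - I)) \<noteq> 0}
      \<subseteq> (\<lambda>(I, J). I \<union> J) ` ({I. f I \<noteq> 0} \<times> {J. g J \<noteq> 0})"
    by fastforce
  then have "finite {K. (\<Sum>I\<in>Pow K. f I * g (K - I)) \<noteq> 0}"
    using f g by (meson finite_SigmaI finite_imageI finite_subset)
  with * f g show "finite {K. (\<Sum>I\<in>Pow K. f I * g (K - I)) \<noteq> 0} \<and>
      (\<forall>K. (\<Sum>I\<in>Pow K. f I * g (K - I)) \<noteq> 0 \<longrightarrow> finite K \<and> 0 \<notin> K)"
    by (metis UnE finite_UnI)
qed

lemma zeon_mult_assoc_aux:
  fixes f g h :: "nat set \<Rightarrow> complex"
  shows "(\<Sum>I\<in>Pow K. (\<Sum>J\<in>Pow I. f J * g (I - J)) * h (K - I)) =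
    (\<Sum>J\<in>Pow K. f J * (\<Sum>L\<in>Pow (K - J). g L * h (K - J - L)))"
proof (cases "finite K")
  case True
  have "(\<Sum>I\<in>Pow K. (\<Sum>J\<in>Pow I. f J * g (I - J)) * h (K - I)) =
      (\<Sum>(I, J)\<in>Sigma (Pow K) Pow. f J * g (I - J) * h (K - I))"
    using True by (subst sum.Sigma[symmetric])
      (auto simp: sum_distrib_right intro: finite_subset)
  also have "\<dots> = (\<Sum>(J, L)\<in>Sigma (Pow K) (\<lambda>J. Pow (K - J)). f J * (g L * h (K - J - L)))"
    by (rule sum.reindex_bij_witness[of _ "\<lambda>(J, L). (J \<union> L, J)" "\<lambda>(I, J). (J, I - J)"])
      (auto simp: mult.assoc intro!: arg_cong[of _ _ h] arg_cong[of _ _ g])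
  also have "\<dots> = (\<Sum>J\<in>Pow K. f J * (\<Sum>L\<in>Pow (K - J). g L * h (K - J - L)))"
    using True by (subst sum.Sigma[symmetric])
      (auto simp: sum_distrib_left)
  finally show ?thesis .
qed simp

lemma zeon_mult_commute_aux:
  fixes f g :: "nat set \<Rightarrow> complex"
  shows "(\<Sum>I\<in>Pow K. f I * g (K - I)) = (\<Sum>I\<in>Pow K. g I * f (K - I))"
  by (rule sum.reindex_bij_witness[of _ "\<lambda>I. K - I" "\<lambda>I. K - I"])
    (auto simp: double_diff)

instance
proof
  fix a b c :: zeon
  show "a * b * c = a * (b * c)"
    by transfer (rule ext, rule zeon_mult_assoc_aux)
  show "a * b = b * a"
    by transfer (rule ext, rule zeon_mult_commute_aux)
  show "1 * a = a"
    unfolding one_zeon_def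
  proof (transfer, rule ext)
    fix f :: "nat set \<Rightarrow> complex" and K
    assume f: "finite {I. f I \<noteq> 0} \<and> (\<forall>I. f I \<noteq> 0 \<longrightarrow> finite I \<and> 0 \<notin> I)"
    let ?s = "\<Sum>I\<in>Pow K. (if I = {} \<and> finite ({} :: nat set) \<and> (0::nat) \<notin> {} then 1 else 0)
        * f (K - I)"
    have s: "?s = (\<Sum>I\<in>Pow K. if I = {} then f K else 0)"
      by (rule sum.cong) auto
    show "?s = f K"
    proof (cases "finite K")
      case True
      then show ?thesis unfolding s by (subst sum.delta) auto
    next
      case False
      with f have "f K = 0" by blast
      with False show ?thesis by simp
    qed
  qed
  show "a + b + c = a + (b + c)" "a + b = b + a" "0 + a = a" "- a + a = 0"
    by (transfer; auto simp: algebra_simps)+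
  show "a - b = a + - b" by (rule minus_zeon_def)
  show "(a + b) * c = a * c + b * c"
    by transfer (simp add: algebra_simps sum.distrib)
  show "(0 :: zeon) \<noteq> 1"
    unfolding one_zeon_def by transfer (auto simp: fun_eq_iff)
qed

end

lemma zeta_empty: "zeta {} = 1"
  by (simp add: one_zeon_def)

lemma zeta_mult:
  assumes "finite I" "0 \<notin> I" "finite J" "0 \<notin> J"
  shows "zeta I * zeta J = (if I \<inter> J = {} then zeta (I \<union> J) else 0)"
proof (rule zeon_eqI)
  fix K
  have "zeon_coeff (zeta I * zeta J) K =
      (\<Sum>L\<in>Pow K. if L = I then (if K - I = J then 1 else 0) else 0)"
    unfolding times_zeon.rep_eq zeta.rep_eq using assms by (intro sum.cong) auto
  also have "\<dots> = (if finite K \<and> I \<subseteq> K \<and> K - I = J then 1 else 0)"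
  proof (cases "finite K")
    case True
    then show ?thesis by (subst sum.delta) auto
  qed simp
  also have "\<dots> = zeon_coeff (if I \<inter> J = {} then zeta (I \<union> J) else 0) K"
    using assms by (auto simp: zeta.rep_eq zero_zeon.rep_eq)
  finally show "zeon_coeff (zeta I * zeta J) K =
    zeon_coeff (if I \<inter> J = {} then zeta (I \<union> J) else 0) K" .
qed

lemma zeon_coeff_sum: "zeon_coeff (\<Sum>i\<in>A. u i) K = (\<Sum>i\<in>A. zeon_coeff (u i) K)"
  by (induction A rule: infinite_finite_induct) (auto simp: zero_zeon.rep_eq plus_zeon.rep_eq)

lemma zeon_expansion:
  "u = (\<Sum>I | zeon_coeff u I \<noteq> 0. zeon_coeff u I *\<^sub>Z zeta I)"
proof (rule zeon_eqI)
  fix K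
  have "zeon_coeff (\<Sum>I | zeon_coeff u I \<noteq> 0. zeon_coeff u I *\<^sub>Z zeta I) K =
      (\<Sum>I | zeon_coeff u I \<noteq> 0. if K = I then zeon_coeff u I else 0)"
    unfolding zeon_coeff_sum zeon_scale.rep_eq zeta.rep_eq
    by (intro sum.cong) (auto dest: zeon_support)
  also have "\<dots> = zeon_coeff u K"
    using finite_zeon_support by (subst sum.delta') auto
  finally show "zeon_coeff u K =
    zeon_coeff (\<Sum>I | zeon_coeff u I \<noteq> 0. zeon_coeff u I *\<^sub>Z zeta I) K" ..
qed

section \<open>Spectrally simple eigenvalues\<close>

definition non_null :: "zeon vec \<Rightarrow> bool" where
  "non_null \<xi> \<longleftrightarrow> scalar_part (map_vec zeon_cnj \<xi> \<bullet> \<xi>) \<noteq> 0"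

definition zeon_eigenvalue :: "zeon mat \<Rightarrow> zeon \<Rightarrow> bool" where
  "zeon_eigenvalue A \<mu> \<longleftrightarrow>
    (\<exists>\<xi> \<in> carrier_vec (dim_row A). non_null \<xi> \<and> A *\<^sub>v \<xi> = \<mu> \<cdot>\<^sub>v \<xi>)"

definition simple_zero :: "zeon poly \<Rightarrow> zeon \<Rightarrow> bool" where
  "simple_zero p \<mu> \<longleftrightarrow> (\<exists>g. p = [:- \<mu>, 1:] * g \<and> poly g \<mu> \<noteq> 0)"

definition spectrally_simple_eigenvalue :: "zeon mat \<Rightarrow> zeon \<Rightarrow> bool" where
  "spectrally_simple_eigenvalue A \<mu> \<longleftrightarrow>
    zeon_eigenvalue A \<mu> \<and>
    simple_zero (char_poly A) \<mu> \<and>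
    order (scalar_part \<mu>) (map_poly scalar_part (char_poly A)) = 1"

section \<open>Graphs\<close>

definition simple_graph :: "'a set \<Rightarrow> 'a set set \<Rightarrow> bool" where
  "simple_graph V E \<longleftrightarrow> finite V \<and> (\<forall>e\<in>E. e \<subseteq> V \<and> card e = 2)"

definition vertex_degree :: "'a set set \<Rightarrow> 'a \<Rightarrow> nat" where
  "vertex_degree E x = card {e \<in> E. x \<in> e}"

text \<open>Matrix indices start at \<open>0\<close>, so row and column \<open>i\<close> belong to the vertex
  \<open>v (Suc i)\<close> of the enumeration \<open>v 1, \<dots>, v m\<close>.\<close>

definition nilpotent_adjacency_matrix :: "nat \<Rightarrow> (nat \<Rightarrow> 'a) \<Rightarrow> 'a set set \<Rightarrow> zeon mat" where
  "nilpotent_adjacency_matrix m v E =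
    mat m m (\<lambda>(i, j). if {v (Suc i), v (Suc j)} \<in> E then zeta {Suc j} else 0)"

definition degree_matrix :: "nat \<Rightarrow> (nat \<Rightarrow> 'a) \<Rightarrow> 'a set set \<Rightarrow> zeon mat" where
  "degree_matrix m v E =
    mat m m (\<lambda>(i, j). if i = j then of_nat (vertex_degree E (v (Suc i))) else 0)"

definition zeon_laplacian :: "nat \<Rightarrow> (nat \<Rightarrow> 'a) \<Rightarrow> 'a set set \<Rightarrow> zeon mat" where
  "zeon_laplacian m v E = degree_matrix m v E - nilpotent_adjacency_matrix m v E"

text \<open>The list \<open>ws\<close> is \<open>(w\<^sub>0, \<dots>, w\<^sub>n)\<close>. The length \<open>n\<close> is required to be positive, so that the
  one-term sequence \<open>(x)\<close> is not a cycle.\<close>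

definition cycle_based_at :: "'a set set \<Rightarrow> nat \<Rightarrow> 'a \<Rightarrow> 'a list \<Rightarrow> bool" where
  "cycle_based_at E n x ws \<longleftrightarrow>
    0 < n \<and> length ws = Suc n \<and> ws ! 0 = x \<and> ws ! n = x \<and>
    (\<forall>i<n. {ws ! i, ws ! Suc i} \<in> E) \<and> distinct (take n ws)"

definition cycles_on :: "(nat \<Rightarrow> 'a) \<Rightarrow> 'a set set \<Rightarrow> 'a \<Rightarrow> nat set \<Rightarrow> 'a list set" where
  "cycles_on v E x I = {ws. \<exists>n. cycle_based_at E n x ws \<and> set (take n ws) = v ` I}"

end

theory Submission
  imports Defs
begin

text \<open>The eigenvector is explicit. Let \<open>\<eta>\<^sub>j\<close> be the sum over all simple paths from \<open>v j\<close> to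
  \<open>v k\<close>, where a path on the vertices indexed by \<open>I\<close> has the weight
  \<open>(-1)\<^bsup>|I|\<^esup> \<zeta>\<^sub>I \<Prod>\<^bsub>i \<in> I - {k}\<^esub> (d - deg (v i))\<^sup>-\<^sup>1\<close>. Removing the first vertex of a path gives
  \<open>\<eta>\<^sub>j = - \<zeta>\<^sub>j \<xi>\<^sub>j\<close>, where \<open>\<xi>\<^sub>k = 1\<close> and \<open>(d - deg (v j)) \<xi>\<^sub>j\<close> is the sum of \<open>\<eta>\<^sub>i\<close> over
  the neighbours \<open>v i\<close> of \<open>v j\<close> for \<open>j \<noteq> k\<close>. Prepending \<open>v k\<close> to a path yields a cycle based
  at \<open>v k\<close>, so \<open>\<lambda> = d + \<Sum>\<^bsub>i \<sim> k\<^esub> \<eta>\<^sub>i\<close>. Both \<open>\<lambda> - d\<close> and \<open>\<xi>\<^sub>j\<close> for \<open>j \<noteq> k\<close> are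
  multiples of \<open>\<zeta>\<^sub>k\<close>; hence \<open>(\<lambda> - d) \<xi>\<^sub>j = 0\<close>, and \<open>\<Lambda> \<xi> = \<lambda> \<xi>\<close> follows row by row.
  Simplicity can be read off the scalar parts, because the scalar part of \<open>\<Lambda>\<close> is \<open>\<Delta>\<close>.\<close>

section \<open>Arithmetic in the zeon algebra\<close>

lemma zeon_coeff_minus: "zeon_coeff (u - v) I = zeon_coeff u I - zeon_coeff v I"
  unfolding minus_zeon_def plus_zeon.rep_eq uminus_zeon.rep_eq by simp

lemmas zeon_coeff_simps =
  zero_zeon.rep_eq plus_zeon.rep_eq uminus_zeon.rep_eq zeon_coeff_minus zeon_scale.rep_eq
  zeon_coeff_sum

lemma zeon_coeff_one: "zeon_coeff 1 I = (if I = {} then 1 else 0)"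
  by (auto simp: one_zeon_def zeta.rep_eq)

lemma zeon_coeff_of_nat_mult: "zeon_coeff (of_nat n * u) I = of_nat n * zeon_coeff u I"
  by (induction n) (auto simp: zeon_coeff_simps algebra_simps)

text \<open>Only the summand \<open>I = {j}\<close> of the convolution survives.\<close>

lemma zeon_coeff_zeta_mult:
  assumes "j \<noteq> 0"
  shows "zeon_coeff (zeta {j} * u) K = (if j \<in> K then zeon_coeff u (K - {j}) else 0)"
proof (cases "finite K")
  case True
  have "zeon_coeff (zeta {j} * u) K =
      (\<Sum>I\<in>Pow K. if I = {j} then zeon_coeff u (K - {j}) else 0)"
    unfolding times_zeon.rep_eq zeta.rep_eq using assms by (intro sum.cong) auto
  then show ?thesis
    using True by (simp add: sum.delta)
next
  \<comment> \<open>Coefficients at infinite sets vanish, so both sides are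
    \<open>0\<close>.\<close>
  case False
  then have "zeon_coeff u (K - {j}) = 0"
    using zeon_support[of u "K - {j}"] by auto
  with False show ?thesis
    using zeon_support[of "zeta {j} * u" K] by auto
qed

lemma zeon_coeff_sum_zeta:
  fixes K :: "nat set"
  assumes "K \<subseteq> {1..m}"
  shows "zeon_coeff (\<Sum>I\<in>Pow {1..m}. f I *\<^sub>Z zeta I) K = f K"
proof -
  have "zeon_coeff (\<Sum>I\<in>Pow {1..m}. f I *\<^sub>Z zeta I) K = (\<Sum>I\<in>Pow {1..m}. if I = K then f K else 0)"
    unfolding zeon_coeff_sum zeon_scale.rep_eq zeta.rep_eq
    by (rule sum.cong) (use assms in \<open>auto intro: finite_subset\<close>)
  also have "\<dots> = f K"
    using assms by (simp add: sum.delta)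
  finally show ?thesis .
qed

lemma zeon_coeff_sum_zeta_outside:
  fixes K :: "nat set"
  assumes "\<not> K \<subseteq> {1..m}"
  shows "zeon_coeff (\<Sum>I\<in>Pow {1..m}. f I *\<^sub>Z zeta I) K = 0"
  unfolding zeon_coeff_sum zeon_scale.rep_eq zeta.rep_eq
  by (rule sum.neutral) (use assms in auto)

text \<open>This extends \<open>zeta {k} * zeta {k} = 0\<close>: when \<open>K\<close> is split into
  \<open>I\<close> and \<open>K - I\<close>, the element \<open>k\<close> cannot lie in both
  pieces.\<close>

lemma zeon_mult_eq_0:
  assumes "\<And>I. zeon_coeff u I \<noteq> 0 \<Longrightarrow> k \<in> I" "\<And>I. zeon_coeff w I \<noteq> 0 \<Longrightarrow> k \<in> I"
  shows "u * w = 0"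
proof (rule zeon_eqI)
  fix K
  have "zeon_coeff u I * zeon_coeff w (K - I) = 0" for I
    using assms(1)[of I] assms(2)[of "K - I"] by auto
  then show "zeon_coeff (u * w) K = zeon_coeff 0 K"
    unfolding times_zeon.rep_eq zero_zeon.rep_eq by (rule sum.neutral[OF ballI])
qed

interpretation scalar_part: comm_ring_hom scalar_part
proof
  show "scalar_part (x + y) = scalar_part x + scalar_part y" for x y
    by transfer simp
  show "scalar_part (x * y) = scalar_part x * scalar_part y" for x y
    by transfer simp
  show "scalar_part 0 = 0"
    by transfer simp
  show "scalar_part 1 = 1"
    by (simp add: scalar_part.rep_eq zeon_coeff_one)
qed

lemma scalar_part_cnj: "scalar_part (zeon_cnj u) = cnj (scalar_part u)"
  by transfer simp

section \<open>Spectrally simple eigenvalues\<close>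

text \<open>On scalar parts the form is a sum of squared moduli, where nothing can cancel a nonzero
  entry.\<close>

lemma non_nullI:
  assumes "i < dim_vec \<xi>" "scalar_part (\<xi> $ i) \<noteq> 0"
  shows "non_null \<xi>"
proof -
  have "scalar_part (map_vec zeon_cnj \<xi> \<bullet> \<xi>) =
      (\<Sum>j<dim_vec \<xi>. cnj (scalar_part (\<xi> $ j)) * scalar_part (\<xi> $ j))"
    by (simp add: scalar_prod_def scalar_part.hom_sum scalar_part.hom_mult scalar_part_cnj
        atLeast0LessThan)
  also have "\<dots> = of_real (\<Sum>j<dim_vec \<xi>. (cmod (scalar_part (\<xi> $ j)))\<^sup>2)"
    unfolding of_real_sum complex_norm_square by (simp only: mult.commute)
  also have "\<dots> \<noteq> 0"
  proof -
    have "0 < (\<Sum>j<dim_vec \<xi>. (cmod (scalar_part (\<xi> $ j)))\<^sup>2)"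
      by (rule sum_pos2[of _ i]) (use assms in auto)
    then show ?thesis by (metis less_irrefl of_real_eq_0_iff)
  qed
  finally show ?thesis by (simp add: non_null_def)
qed

section \<open>Roots of the characteristic polynomial\<close>

lemma poly_char_poly:
  fixes A :: "'a :: comm_ring_1 mat"
  assumes "A \<in> carrier_mat n n"
  shows "poly (char_poly A) \<mu> = det (\<mu> \<cdot>\<^sub>m 1\<^sub>m n - A)"
  unfolding char_poly_def
proof (rule poly_det_cong[of _ n])
  show "\<mu> \<cdot>\<^sub>m 1\<^sub>m n - A \<in> carrier_mat n n"
    by (rule minus_carrier_mat[OF assms])
qed (use assms in \<open>auto simp: char_poly_matrix_def\<close>)

text \<open>With zero divisors around, a nonzero kernel vector does not force
  \<open>det B = 0\<close>. The adjugate still shows that \<open>det B\<close> annihilates \<xi>,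
  and the entry \<open>1\<close> of \<xi> then isolates \<open>det B\<close>.\<close>

lemma char_poly_root:
  fixes A :: "'a :: comm_ring_1 mat"
  assumes A: "A \<in> carrier_mat n n" and \<xi>: "\<xi> \<in> carrier_vec n"
    and eig: "A *\<^sub>v \<xi> = \<mu> \<cdot>\<^sub>v \<xi>" and i: "i < n" "\<xi> $ i = 1"
  shows "poly (char_poly A) \<mu> = 0"
proof -
  define B where "B = \<mu> \<cdot>\<^sub>m 1\<^sub>m n - A"
  have B: "B \<in> carrier_mat n n"
    unfolding B_def using A by (rule minus_carrier_mat)
  have scaled_one: "(c \<cdot>\<^sub>m 1\<^sub>m n) *\<^sub>v \<xi> = c \<cdot>\<^sub>v \<xi>" for c
    using \<xi> by auto
  have "B *\<^sub>v \<xi> = (\<mu> \<cdot>\<^sub>m 1\<^sub>m n) *\<^sub>v \<xi> - A *\<^sub>v \<xi>"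
    unfolding B_def by (rule minus_mult_distrib_mat_vec) (use A \<xi> in auto)
  also have "(\<mu> \<cdot>\<^sub>m 1\<^sub>m n) *\<^sub>v \<xi> = \<mu> \<cdot>\<^sub>v \<xi>"
    by (rule scaled_one)
  finally have B0: "B *\<^sub>v \<xi> = 0\<^sub>v n"
    using \<xi> eig by auto
  have "(det B \<cdot>\<^sub>m 1\<^sub>m n) *\<^sub>v \<xi> = adj_mat B *\<^sub>v (B *\<^sub>v \<xi>)"
    using adj_mat[OF B] B \<xi> by (metis assoc_mult_mat_vec)
  also have "\<dots> = 0\<^sub>v n"
    unfolding B0 using adj_mat(1)[OF B] by auto
  finally have "det B \<cdot>\<^sub>v \<xi> = 0\<^sub>v n"
    by (simp only: scaled_one)
  then have "(det B \<cdot>\<^sub>v \<xi>) $ i = 0"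
    using i by simp
  then have "det B = 0"
    using i \<xi> by simp
  then show ?thesis
    by (simp add: poly_char_poly[OF A] B_def)
qed

text \<open>Simplicity over the zeon algebra is inherited from the complex polynomial: the cofactor
  of the linear factor keeps a nonzero scalar part at \<mu>.\<close>

lemma spectrally_simple_eigenvalueI:
  assumes A: "A \<in> carrier_mat n n" and \<xi>: "\<xi> \<in> carrier_vec n"
    and eig: "A *\<^sub>v \<xi> = \<mu> \<cdot>\<^sub>v \<xi>" and i: "i < n" "\<xi> $ i = 1"
    and order: "order (scalar_part \<mu>) (char_poly (map_mat scalar_part A)) = 1"
  shows "spectrally_simple_eigenvalue A \<mu>"
proof -
  interpret map_scalar_part: map_poly_comm_ring_hom scalar_part ..
  have \<chi>: "char_poly (map_mat scalar_part A) = map_poly scalar_part (char_poly A)"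
    by (rule scalar_part.char_poly_hom[OF A])
  have "non_null \<xi>"
    by (rule non_nullI[of i]) (use i \<xi> in auto)
  then have "zeon_eigenvalue A \<mu>"
    unfolding zeon_eigenvalue_def using A \<xi> eig by auto
  moreover have "simple_zero (char_poly A) \<mu>"
  proof -
    from char_poly_root[OF A \<xi> eig i] obtain g where g: "char_poly A = [:- \<mu>, 1:] * g"
      by (auto simp: poly_eq_0_iff_dvd elim: dvdE)
    define s h where "s = scalar_part \<mu>" and "h = map_poly scalar_part g"
    have "map_poly scalar_part [:- \<mu>, 1:] = [:- s, 1:]"
      by (simp add: s_def scalar_part.hom_uminus)
    then have eq: "char_poly (map_mat scalar_part A) = [:- s, 1:] * h"
      unfolding \<chi> g map_scalar_part.hom_mult h_def by simp
    have "char_poly (map_mat scalar_part A) \<noteq> 0"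
      using degree_monic_char_poly[of "map_mat scalar_part A" n] A by auto
    \<comment> \<open>The linear factor uses up the whole order \<open>1\<close>, so
      \<open>s\<close> is not a root of \<open>h\<close>; and \<open>poly h s\<close> is the scalar
      part of \<open>poly g \<mu>\<close>.\<close>
    then have "order s (char_poly (map_mat scalar_part A)) = Suc (order s h)"
      unfolding eq using order_power_n_n[of s 1] by (subst order_mult) auto
    with order have "order s h = 0"
      by (simp add: s_def)
    moreover have "h \<noteq> 0"
      using \<open>char_poly _ \<noteq> 0\<close> eq by auto
    ultimately have "poly h s \<noteq> 0"
      by (simp add: order_root)
    then have "poly g \<mu> \<noteq> 0"
      by (metis h_def s_def scalar_part.hom_zero scalar_part.poly_map_poly)
    with g show ?thesis
      unfolding simple_zero_def by blast
  qed
  ultimately show ?thesis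
    unfolding spectrally_simple_eigenvalue_def using order \<chi> by simp
qed

section \<open>Simple paths\<close>

definition simple_paths :: "'a set set \<Rightarrow> 'a \<Rightarrow> 'a \<Rightarrow> 'a set \<Rightarrow> 'a list set" where
  "simple_paths E x y S = {ps. ps \<noteq> [] \<and> hd ps = x \<and> last ps = y \<and> distinct ps \<and> set ps = S \<and>
    successively (\<lambda>a b. {a, b} \<in> E) ps}"

lemma finite_simple_paths:
  assumes "finite S"
  shows "finite (simple_paths E x y S)"
  by (rule finite_subset[OF _ finite_subset_distinct[OF assms]]) (auto simp: simple_paths_def)

text \<open>Base case of the recursion on paths: without repetitions, equal first and last vertices
  leave room for one entry only.\<close>

lemma simple_paths_self: "simple_paths E x x S = (if S = {x} then {[x]} else {})"
proof -
  have sub: "ps = [x] \<and> S = {x}" if ps: "ps \<in> simple_paths E x x S" for ps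
  proof -
    from ps have "ps \<noteq> []" "hd ps = x" "last ps = x" "distinct ps" and S: "set ps = S"
      by (simp_all add: simple_paths_def)
    then have "ps = [x]"
      by (cases ps) (auto split: if_splits)
    with S show ?thesis
      by simp
  qed
  have mem: "[x] \<in> simple_paths E x x {x}"
    by (simp add: simple_paths_def)
  show ?thesis
  proof (cases "S = {x}")
    case True
    have "simple_paths E x x {x} = {[x]}"
      using sub mem unfolding True by blast
    with True show ?thesis
      by simp
  next
    case False
    then have "simple_paths E x x S = {}"
      using sub by blast
    with False show ?thesis
      by simp
  qed
qed

text \<open>Stripping the first vertex leaves a path from a neighbour; \<open>x \<noteq> y\<close>
  ensures that it is nonempty, and \<open>S - {x}\<close> records that \<open>x\<close> is not
  visited again.\<close>

lemma simple_paths_unfold: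
  assumes "x \<noteq> y" "x \<in> S"
  shows "simple_paths E x y S = (\<Union>z\<in>{z. {x, z} \<in> E}. (#) x ` simple_paths E z y (S - {x}))"
proof (intro Set.set_eqI iffI)
  fix ps assume ps: "ps \<in> simple_paths E x y S"
  then obtain qs where qs: "ps = x # qs"
    by (cases ps) (auto simp: simple_paths_def)
  with ps assms have "qs \<noteq> []"
    by (auto simp: simple_paths_def)
  with ps qs have "{x, hd qs} \<in> E" "qs \<in> simple_paths E (hd qs) y (S - {x})"
    by (auto simp: simple_paths_def successively_Cons)
  with qs show "ps \<in> (\<Union>z\<in>{z. {x, z} \<in> E}. (#) x ` simple_paths E z y (S - {x}))"
    by auto
next
  fix ps assume "ps \<in> (\<Union>z\<in>{z. {x, z} \<in> E}. (#) x ` simple_paths E z y (S - {x}))"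
  then obtain qs z where "ps = x # qs" "{x, z} \<in> E" "qs \<in> simple_paths E z y (S - {x})"
    by auto
  then show "ps \<in> simple_paths E x y S"
    using assms(2) by (auto simp: simple_paths_def successively_Cons)
qed

text \<open>Both end points of a cycle are equal, so deleting the first one leaves a simple path with the
  same vertex set.\<close>

lemma cycles_on_eq:
  "cycles_on v E x I = (\<Union>z\<in>{z. {x, z} \<in> E}. (#) x ` simple_paths E z x (v ` I))"
proof (intro Set.set_eqI iffI)
  fix ws assume "ws \<in> cycles_on v E x I"
  then obtain n where n: "cycle_based_at E n x ws" and S: "set (take n ws) = v ` I"
    by (auto simp: cycles_on_def)
  then obtain ps where ps: "ws = x # ps" "length ps = n" "n > 0"
    by (cases ws) (auto simp: cycle_based_at_def)
  then have ne: "ps \<noteq> []"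
    by auto
  have last: "last ps = x"
    using n ps ne by (auto simp: cycle_based_at_def last_conv_nth nth_Cons split: nat.splits)
  \<comment> \<open>\<open>take n ws\<close> contains the copy of \<open>x\<close> at position
    \<open>0\<close> of \<open>ws\<close>, while \<open>ps\<close> contains the one at position
    \<open>n\<close>. Otherwise they agree, so distinctness and vertex set carry over.\<close>
  have take: "take n ws = x # butlast ps"
    using ps by (cases n) (auto simp: butlast_conv_take)
  have split: "ps = butlast ps @ [x]"
    using ne last by (metis append_butlast_last_id)
  have "successively (\<lambda>a b. {a, b} \<in> E) ws"
    using n by (auto simp: cycle_based_at_def successively_conv_nth)
  moreover have "distinct (x # butlast ps)"
    using n take by (simp add: cycle_based_at_def)
  then have "distinct ps"
    by (subst split) auto
  moreover have "set ps = v ` I"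
    by (subst split) (use S take in auto)
  ultimately have "{x, hd ps} \<in> E" "ps \<in> simple_paths E (hd ps) x (v ` I)"
    using ps ne last by (auto simp: simple_paths_def successively_Cons)
  with ps show "ws \<in> (\<Union>z\<in>{z. {x, z} \<in> E}. (#) x ` simple_paths E z x (v ` I))"
    by auto
next
  fix ws assume "ws \<in> (\<Union>z\<in>{z. {x, z} \<in> E}. (#) x ` simple_paths E z x (v ` I))"
  then obtain ps z where ps: "ws = x # ps" "{x, z} \<in> E" "ps \<in> simple_paths E z x (v ` I)"
    by auto
  then have ne: "ps \<noteq> []" and last: "last ps = x" and "distinct ps" "set ps = v ` I"
    and succ: "successively (\<lambda>a b. {a, b} \<in> E) ws"
    by (auto simp: simple_paths_def successively_Cons)
  define n where "n = length ps"
  have "n > 0"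
    using ne by (simp add: n_def)
  have take: "take n ws = x # butlast ps"
    using ps ne by (cases n) (auto simp: n_def butlast_conv_take)
  have split: "ps = butlast ps @ [x]"
    using ne last by (metis append_butlast_last_id)
  have "distinct (butlast ps @ [x])"
    using \<open>distinct ps\<close> split by simp
  then have "distinct (take n ws)"
    unfolding take by auto
  moreover have "set (butlast ps @ [x]) = v ` I"
    using \<open>set ps = v ` I\<close> split by simp
  then have "set (take n ws) = v ` I"
    unfolding take by auto
  moreover have "ws ! n = x"
    using \<open>n > 0\<close> last ne ps by (simp add: n_def last_conv_nth)
  ultimately have "cycle_based_at E n x ws"
    using \<open>n > 0\<close> succ ps by (auto simp: cycle_based_at_def n_def successively_conv_nth)
  with \<open>set (take n ws) = v ` I\<close> show "ws \<in> cycles_on v E x I"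
    by (auto simp: cycles_on_def)
qed

section \<open>The eigenvector of the Laplacian\<close>

locale unique_degree_vertex =
  fixes V :: "'a set" and E :: "'a set set" and v :: "nat \<Rightarrow> 'a" and m d k :: nat
  assumes graph: "simple_graph V E"
    and enum: "bij_betw v {1..m} V"
    and k: "k \<in> {1..m}"
    and deg_k: "vertex_degree E (v k) = d"
    and unique: "\<And>x. x \<in> V \<Longrightarrow> vertex_degree E x = d \<Longrightarrow> x = v k"
begin

definition nbrs :: "nat \<Rightarrow> nat set" where
  "nbrs j = {i \<in> {1..m}. {v j, v i} \<in> E}"

abbreviation inv_diff :: "nat \<Rightarrow> complex" where
  "inv_diff j \<equiv> inverse (of_nat d - of_nat (vertex_degree E (v j)))"

abbreviation num_paths :: "nat \<Rightarrow> nat set \<Rightarrow> nat" where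
  "num_paths j I \<equiv> card (simple_paths E (v j) (v k) (v ` I))"

text \<open>The index \<open>k\<close> is left out because \<open>inv_diff k\<close> is
  \<open>inverse 0\<close>, hence \<open>0\<close>.\<close>

definition path_weight :: "nat \<Rightarrow> nat set \<Rightarrow> complex" where
  "path_weight j I = (-1) ^ card I * of_nat (num_paths j I) * (\<Prod>i\<in>I - {k}. inv_diff i)"

definition path_sum :: "nat \<Rightarrow> zeon" where
  "path_sum j = (\<Sum>I\<in>Pow {1..m}. path_weight j I *\<^sub>Z zeta I)"

definition eigvec_entry :: "nat \<Rightarrow> zeon" where
  "eigvec_entry j = (if j = k then 1 else inv_diff j *\<^sub>Z (\<Sum>i\<in>nbrs j. path_sum i))"

definition eigval :: zeon where
  "eigval = of_nat d + (\<Sum>i\<in>nbrs k. path_sum i)"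

section \<open>Counting paths and cycles through neighbours\<close>

lemma inj: "inj_on v {1..m}"
  using enum by (auto simp: bij_betw_def)

text \<open>Makes \<open>inv_diff j\<close> a true inverse for every
  \<open>j \<noteq> k\<close>.\<close>

lemma degree_neq:
  assumes "j \<in> {1..m}" "j \<noteq> k"
  shows "vertex_degree E (v j) \<noteq> d"
proof
  assume "vertex_degree E (v j) = d"
  moreover have "v j \<in> V"
    using enum assms by (auto simp: bij_betw_def)
  ultimately have "v j = v k"
    using unique by blast
  with assms k show False
    using inj by (auto dest: inj_onD)
qed

lemma nbrs_image: "{z. {v j, z} \<in> E} = v ` nbrs j"
  using graph enum by (fastforce simp: simple_graph_def bij_betw_def nbrs_def)

lemma finite_nbrs [simp]: "finite (nbrs j)"
  by (simp add: nbrs_def)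

text \<open>Serves both the path recursion and the cycle count. The union is disjoint because the
  second vertex of a list determines the index \<open>i\<close>.\<close>

lemma card_prepend:
  assumes "finite S"
  shows "card (\<Union>z\<in>{z. {v j, z} \<in> E}. (#) x ` simple_paths E z y S) =
    (\<Sum>i\<in>nbrs j. card (simple_paths E (v i) y S))"
proof -
  have inj': "inj_on v (nbrs j)"
    using inj by (rule inj_on_subset) (auto simp: nbrs_def)
  have "card (\<Union>i\<in>nbrs j. (#) x ` simple_paths E (v i) y S) =
      (\<Sum>i\<in>nbrs j. card ((#) x ` simple_paths E (v i) y S))"
  proof (rule card_UN_disjoint)
    show "\<forall>i\<in>nbrs j. \<forall>i'\<in>nbrs j. i \<noteq> i' \<longrightarrow>
        (#) x ` simple_paths E (v i) y S \<inter> (#) x ` simple_paths E (v i') y S = {}"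
      using inj' by (auto simp: simple_paths_def dest: inj_onD)
  qed (auto intro: finite_simple_paths[OF assms])
  then show ?thesis
    by (simp add: nbrs_image card_image)
qed

lemma card_cycles_on:
  assumes "finite I"
  shows "card (cycles_on v E (v k) I) = (\<Sum>i\<in>nbrs k. num_paths i I)"
  unfolding cycles_on_eq using assms by (simp add: card_prepend)

lemma num_paths_unfold:
  assumes "j \<in> {1..m}" "j \<noteq> k" "I \<subseteq> {1..m}" "j \<in> I"
  shows "num_paths j I = (\<Sum>i\<in>nbrs j. num_paths i (I - {j}))"
proof -
  have "v j \<noteq> v k"
    using assms k inj by (auto dest: inj_onD)
  moreover have "v ` I - {v j} = v ` (I - {j})"
    using inj_on_image_set_diff[OF inj, of I "{j}"] assms by auto
  moreover have "finite I"
    using assms finite_subset by blast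
  ultimately show ?thesis
    using assms by (subst simple_paths_unfold) (simp_all add: card_prepend)
qed

section \<open>Path weights and path sums\<close>

lemma path_weight_outside:
  assumes "j \<in> {1..m}" "I \<subseteq> {1..m}" "j \<notin> I \<or> k \<notin> I"
  shows "path_weight j I = 0"
proof -
  have "v j \<notin> v ` I \<or> v k \<notin> v ` I"
    using assms k inj by (auto simp: inj_on_image_mem_iff)
  moreover have "v j \<in> v ` I \<and> v k \<in> v ` I" if "ps \<in> simple_paths E (v j) (v k) (v ` I)" for ps
  proof -
    from that have "ps \<noteq> []" "hd ps = v j" "last ps = v k" "set ps = v ` I"
      by (simp_all add: simple_paths_def)
    then show ?thesis
      using hd_in_set[of ps] last_in_set[of ps] by simp
  qed
  ultimately have "simple_paths E (v j) (v k) (v ` I) = {}"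
    by blast
  then show ?thesis
    by (simp add: path_weight_def)
qed

text \<open>Deleting \<open>j\<close> from \<open>I\<close> removes one sign and, as
  \<open>j \<noteq> k\<close>, the factor \<open>inv_diff j\<close>; the counts follow the path
  recursion.\<close>

lemma path_weight_unfold:
  assumes j: "j \<in> {1..m}" "j \<noteq> k" and I: "I \<subseteq> {1..m}" "j \<in> I"
  shows "path_weight j I = - inv_diff j * (\<Sum>i\<in>nbrs j. path_weight i (I - {j}))"
proof -
  have fin: "finite I"
    using I finite_subset by blast
  have prod: "(\<Prod>i\<in>I - {k}. inv_diff i) = inv_diff j * (\<Prod>i\<in>I - {j} - {k}. inv_diff i)"
    using fin I j by (subst prod.remove[of _ j]) (auto intro!: prod.cong)
  have card: "card I = Suc (card (I - {j}))"
    using card_Suc_Diff1[OF fin I(2)] by simp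
  show ?thesis
    unfolding path_weight_def num_paths_unfold[OF j I] prod card
    by (simp add: sum_distrib_left sum_distrib_right mult_ac)
qed

text \<open>The one-vertex path is the only one from \<open>v k\<close> to itself, so
  \<open>path_sum k\<close> is \<open>- zeta {k}\<close>.\<close>

lemma path_weight_k:
  assumes "I \<subseteq> {1..m}"
  shows "path_weight k I = (if I = {k} then -1 else 0)"
proof -
  have "v ` I = {v k} \<longleftrightarrow> I = {k}"
    using inj_on_image_eq_iff[OF inj, of I "{k}"] assms k by auto
  then show ?thesis
    by (auto simp: path_weight_def simple_paths_self)
qed

lemma path_sum_coeff:
  "zeon_coeff (path_sum j) I = (if I \<subseteq> {1..m} then path_weight j I else 0)"
  unfolding path_sum_def
  by (simp add: zeon_coeff_sum_zeta zeon_coeff_sum_zeta_outside del: One_nat_def)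

lemma path_sum_support:
  assumes "j \<in> {1..m}" "zeon_coeff (path_sum j) I \<noteq> 0"
  shows "k \<in> I"
proof (rule ccontr)
  assume "k \<notin> I"
  then have "zeon_coeff (path_sum j) I = 0"
    using path_weight_outside[OF assms(1), of I] by (simp add: path_sum_coeff)
  with assms(2) show False
    by simp
qed

text \<open>All paths counted here end in \<open>v k\<close>, so these sums are multiples of
  \<open>zeta {k}\<close>.\<close>

lemma sum_path_sum_support:
  assumes "zeon_coeff (\<Sum>i\<in>nbrs j. path_sum i) I \<noteq> 0"
  shows "k \<in> I"
proof -
  obtain i where "i \<in> nbrs j" "zeon_coeff (path_sum i) I \<noteq> 0"
    using assms unfolding zeon_coeff_sum by (rule sum.not_neutral_contains_not_neutral)
  then show ?thesis
    using path_sum_support[of i I] by (auto simp: nbrs_def)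
qed

text \<open>Multiplying by \<open>zeta {j}\<close> prepends \<open>v j\<close> to the paths in the
  entry and kills those already visiting \<open>v j\<close>; the extra vertex costs a sign. For
  \<open>j = k\<close> the entry \<open>1\<close> acts as the empty path.\<close>

lemma zeta_mult_eigvec_entry:
  assumes j: "j \<in> {1..m}"
  shows "zeta {j} * eigvec_entry j = - path_sum j"
proof (rule zeon_eqI)
  fix I
  have "j \<noteq> 0"
    using j by auto
  have coeff: "zeon_coeff (zeta {j} * eigvec_entry j) I =
      (if j \<in> I then zeon_coeff (eigvec_entry j) (I - {j}) else 0)"
    by (rule zeon_coeff_zeta_mult[OF \<open>j \<noteq> 0\<close>])
  have "(if j \<in> I then zeon_coeff (eigvec_entry j) (I - {j}) else 0) =
      - (if I \<subseteq> {1..m} then path_weight j I else 0)"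
  proof (cases "I \<subseteq> {1..m} \<and> j \<in> I")
    case False
    then have "\<not> I - {j} \<subseteq> {1..m}" if "j \<in> I"
      using j that by blast
    moreover from this have "I - {j} \<noteq> {}" if "j \<in> I"
      using that by blast
    moreover have "path_weight j I = 0" if "I \<subseteq> {1..m}"
      using False path_weight_outside[OF j that] that by blast
    ultimately show ?thesis
      by (auto simp: eigvec_entry_def zeon_coeff_one zeon_coeff_simps path_sum_coeff
          simp del: One_nat_def)
  next
    case True
    then have I: "I \<subseteq> {1..m}" "j \<in> I" and sub: "I - {j} \<subseteq> {1..m}"
      by auto
    show ?thesis
    proof (cases "j = k")
      case True
      moreover have "I - {j} = {} \<longleftrightarrow> I = {j}"
        using I by auto
      ultimately show ?thesis
        using I by (simp add: eigvec_entry_def zeon_coeff_one path_weight_k del: One_nat_def)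
    next
      case False
      then show ?thesis
        using I sub unfolding path_weight_unfold[OF j False I]
        by (simp add: eigvec_entry_def zeon_coeff_simps path_sum_coeff del: One_nat_def)
    qed
  qed
  then show "zeon_coeff (zeta {j} * eigvec_entry j) I = zeon_coeff (- path_sum j) I"
    by (simp add: coeff uminus_zeon.rep_eq path_sum_coeff del: One_nat_def)
qed

text \<open>This is row \<open>j\<close> of the eigenvalue equation with the off-diagonal part
  expressed by path sums. For \<open>j = k\<close> it is the definition of \<open>eigval\<close>;
  elsewhere \<open>eigval\<close> acts on the entry as \<open>d\<close> does.\<close>

lemma eigvec_entry_eq:
  assumes j: "j \<in> {1..m}"
  shows "of_nat (vertex_degree E (v j)) * eigvec_entry j + (\<Sum>i\<in>nbrs j. path_sum i) =
    eigval * eigvec_entry j"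
proof (cases "j = k")
  case True
  then show ?thesis
    by (simp add: eigvec_entry_def eigval_def deg_k)
next
  case False
  let ?S = "\<Sum>i\<in>nbrs j. path_sum i"
  have entry: "eigvec_entry j = inv_diff j *\<^sub>Z ?S"
    using False by (simp add: eigvec_entry_def)
  \<comment> \<open>Both factors are supported on sets containing \<open>k\<close>.\<close>
  have "(\<Sum>i\<in>nbrs k. path_sum i) * eigvec_entry j = 0"
    by (rule zeon_mult_eq_0[of _ k])
      (auto intro: sum_path_sum_support simp: entry zeon_scale.rep_eq)
  then have "eigval * eigvec_entry j = of_nat d * eigvec_entry j"
    by (simp add: eigval_def distrib_right)
  also have "\<dots> = of_nat (vertex_degree E (v j)) * eigvec_entry j + ?S"
  proof (rule zeon_eqI)
    fix I
    have "of_nat d - of_nat (vertex_degree E (v j)) \<noteq> (0 :: complex)"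
      using degree_neq[OF j False] by simp
    then show "zeon_coeff (of_nat d * eigvec_entry j) I =
        zeon_coeff (of_nat (vertex_degree E (v j)) * eigvec_entry j + ?S) I"
      by (simp add: entry plus_zeon.rep_eq zeon_coeff_of_nat_mult zeon_scale.rep_eq field_simps)
  qed
  finally show ?thesis ..
qed

section \<open>The eigenvalue equation in matrix form\<close>

lemma laplacian_carrier: "zeon_laplacian m v E \<in> carrier_mat m m"
  unfolding zeon_laplacian_def
  by (rule minus_carrier_mat) (simp add: nilpotent_adjacency_matrix_def)

lemma laplacian_mult_eigvec:
  "zeon_laplacian m v E *\<^sub>v vec m (\<lambda>i. eigvec_entry (Suc i)) =
    eigval \<cdot>\<^sub>v vec m (\<lambda>i. eigvec_entry (Suc i))"
proof (rule eq_vecI)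
  fix i assume "i < dim_vec (eigval \<cdot>\<^sub>v vec m (\<lambda>i. eigvec_entry (Suc i)))"
  then have i: "i < m"
    by simp
  have "(zeon_laplacian m v E *\<^sub>v vec m (\<lambda>i. eigvec_entry (Suc i))) $ i =
      (\<Sum>j<m. ((if i = j then of_nat (vertex_degree E (v (Suc i))) else 0) -
        (if {v (Suc i), v (Suc j)} \<in> E then zeta {Suc j} else 0)) * eigvec_entry (Suc j))"
    using i by (simp add: zeon_laplacian_def degree_matrix_def nilpotent_adjacency_matrix_def
        scalar_prod_def atLeast0LessThan)
  also have "\<dots> = (\<Sum>j<m. if i = j then of_nat (vertex_degree E (v (Suc i))) * eigvec_entry (Suc j)
        else 0) - (\<Sum>j<m. if {v (Suc i), v (Suc j)} \<in> E then zeta {Suc j} * eigvec_entry (Suc j)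
        else 0)"
    unfolding sum_subtractf[symmetric] by (rule sum.cong) (auto simp: algebra_simps)
  also have "\<dots> = of_nat (vertex_degree E (v (Suc i))) * eigvec_entry (Suc i) -
      (\<Sum>j<m. if {v (Suc i), v (Suc j)} \<in> E then - path_sum (Suc j) else 0)"
    using i by (intro arg_cong2[of _ _ _ _ "(-)"] sum.cong)
      (auto simp: sum.delta' zeta_mult_eigvec_entry)
  \<comment> \<open>Passes from matrix indices starting at \<open>0\<close> to vertex indices
    starting at \<open>1\<close>.\<close>
  also have "(\<Sum>j<m. if {v (Suc i), v (Suc j)} \<in> E then - path_sum (Suc j) else 0) =
      (\<Sum>j\<in>{1..m}. if {v (Suc i), v j} \<in> E then - path_sum j else 0)"
    by (rule sum.reindex_bij_witness[of _ "\<lambda>j. j - 1" Suc]) auto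
  also have "\<dots> = - (\<Sum>j\<in>nbrs (Suc i). path_sum j)"
    unfolding nbrs_def sum_negf[symmetric] by (rule sum.inter_filter[symmetric]) simp
  finally show "(zeon_laplacian m v E *\<^sub>v vec m (\<lambda>i. eigvec_entry (Suc i))) $ i =
      (eigval \<cdot>\<^sub>v vec m (\<lambda>i. eigvec_entry (Suc i))) $ i"
    using i eigvec_entry_eq[of "Suc i"] by simp
qed (simp add: zeon_laplacian_def nilpotent_adjacency_matrix_def)

section \<open>Scalar parts and simplicity\<close>

lemma scalar_part_eigval: "scalar_part eigval = of_nat d"
proof -
  \<comment> \<open>The scalar part is the coefficient at \<open>{}\<close>, which does not contain
    \<open>k\<close>.\<close>
  have "scalar_part (\<Sum>i\<in>nbrs k. path_sum i) = 0"
    using sum_path_sum_support[of k "{}"] by (auto simp: scalar_part.rep_eq)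
  then show ?thesis
    by (simp add: eigval_def scalar_part.hom_add scalar_part.hom_of_nat)
qed

text \<open>Scalar parts turn the Laplacian into the diagonal degree matrix. The degree
  \<open>d\<close> occurs there only once, so exactly one linear factor vanishes at
  \<open>d\<close>.\<close>

lemma order_scalar_char_poly:
  "order (of_nat d) (char_poly (map_mat scalar_part (zeon_laplacian m v E))) = 1"
proof -
  let ?A = "map_mat scalar_part (zeon_laplacian m v E)"
  let ?f = "\<lambda>i. [:- of_nat (vertex_degree E (v (Suc i))), 1:] :: complex poly"
  \<comment> \<open>The matrix position of \<open>v k\<close>.\<close>
  let ?k = "k - 1"
  have entry: "?A $$ (i, j) = (if i = j then of_nat (vertex_degree E (v (Suc i))) else 0)"
    if "i < m" "j < m" for i j
  proof -
    have "scalar_part (zeta {Suc j}) = 0"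
      by (simp add: scalar_part.rep_eq zeta.rep_eq)
    then show ?thesis
      using that by (auto simp: zeon_laplacian_def degree_matrix_def
          nilpotent_adjacency_matrix_def scalar_part.hom_minus scalar_part.hom_of_nat)
  qed
  have A: "?A \<in> carrier_mat m m"
    using laplacian_carrier by simp
  have "upper_triangular ?A"
    using A by (auto simp: entry simp del: index_map_mat(1))
  then have "char_poly ?A = (\<Prod>a\<leftarrow>diag_mat ?A. [:- a, 1:])"
    by (rule char_poly_upper_triangular[OF A])
  also have "diag_mat ?A = map (\<lambda>i. of_nat (vertex_degree E (v (Suc i)))) [0..<m]"
    using A entry by (auto simp: diag_mat_def simp del: index_map_mat(1))
  also have "(\<Prod>a\<leftarrow>map (\<lambda>i. of_nat (vertex_degree E (v (Suc i)))) [0..<m]. [:- a, 1:]) =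
      (\<Prod>i<m. ?f i)"
    using prod.distinct_set_conv_list[of "[0..<m]" ?f] by (simp add: comp_def atLeast0LessThan)
  also have "\<dots> = [:- of_nat d, 1:] * (\<Prod>i\<in>{..<m} - {?k}. ?f i)"
    using k by (subst prod.remove[of _ ?k]) (auto simp: deg_k)
  finally have eq: "char_poly ?A = [:- of_nat d, 1:] * (\<Prod>i\<in>{..<m} - {?k}. ?f i)" .
  have "poly (\<Prod>i\<in>{..<m} - {?k}. ?f i) (of_nat d) \<noteq> 0"
  proof -
    have "vertex_degree E (v (Suc i)) \<noteq> d" if "i < m" "i \<noteq> ?k" for i
      using that k by (intro degree_neq) auto
    then show ?thesis
      by (auto simp: poly_prod)
  qed
  moreover from this have "(\<Prod>i\<in>{..<m} - {?k}. ?f i) \<noteq> 0"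
    by auto
  ultimately show ?thesis
    unfolding eq using order_power_n_n[of "of_nat d :: complex" 1]
    by (subst order_mult) (auto simp: order_0I simp del: mult_pCons_left)
qed

lemma spectrally_simple_eigval: "spectrally_simple_eigenvalue (zeon_laplacian m v E) eigval"
proof (rule spectrally_simple_eigenvalueI)
  show "zeon_laplacian m v E *\<^sub>v vec m (\<lambda>i. eigvec_entry (Suc i)) =
      eigval \<cdot>\<^sub>v vec m (\<lambda>i. eigvec_entry (Suc i))"
    by (rule laplacian_mult_eigvec)
  show "k - 1 < m" "vec m (\<lambda>i. eigvec_entry (Suc i)) $ (k - 1) = 1"
    using k by (auto simp: eigvec_entry_def)
  show "order (scalar_part eigval) (char_poly (map_mat scalar_part (zeon_laplacian m v E))) = 1"
    by (simp add: scalar_part_eigval order_scalar_char_poly)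
qed (auto intro: laplacian_carrier)

section \<open>Coefficients of the eigenvalue as cycle counts\<close>

lemma eigval_eq:
  assumes \<omega>: "\<And>I. I \<subseteq> {1..m} \<Longrightarrow> (-1) ^ card I * \<omega> I = int (card (cycles_on v E (v k) I))"
  shows "eigval = of_nat d +
    (\<Sum>I\<in>Pow {1..m}. (of_int (\<omega> I) * (\<Prod>j\<in>I - {k}. inv_diff j)) *\<^sub>Z zeta I)"
proof -
  have weight: "(\<Sum>i\<in>nbrs k. path_weight i I) = of_int (\<omega> I) * (\<Prod>j\<in>I - {k}. inv_diff j)"
    if I: "I \<subseteq> {1..m}" for I
  proof -
    have fin: "finite I"
      using I finite_subset by blast
    \<comment> \<open>The sign is its own inverse, so the hypothesis can be solved for
      \<open>\<omega> I\<close>.\<close>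
    have "\<omega> I = (-1) ^ card I * ((-1) ^ card I * \<omega> I)"
      by (simp add: mult.assoc[symmetric] power_add[symmetric])
    also have "\<dots> = (-1) ^ card I * int (\<Sum>i\<in>nbrs k. num_paths i I)"
      by (simp only: \<omega>[OF I] card_cycles_on[OF fin])
    finally have "of_int (\<omega> I) = (-1) ^ card I * (\<Sum>i\<in>nbrs k. of_nat (num_paths i I) :: complex)"
      by simp
    then show ?thesis
      by (simp add: path_weight_def sum_distrib_left sum_distrib_right)
  qed
  have "(\<Sum>i\<in>nbrs k. path_sum i) =
      (\<Sum>I\<in>Pow {1..m}. (of_int (\<omega> I) * (\<Prod>j\<in>I - {k}. inv_diff j)) *\<^sub>Z zeta I)"
    (is "?l = ?r")
  proof (rule zeon_eqI)
    show "zeon_coeff ?l I = zeon_coeff ?r I" for I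
      by (cases "I \<subseteq> {1..m}")
        (simp_all add: zeon_coeff_sum[of path_sum] path_sum_coeff weight zeon_coeff_sum_zeta
          zeon_coeff_sum_zeta_outside del: One_nat_def)
  qed
  then show ?thesis
    by (simp add: eigval_def)
qed

end

theorem theorem3p7:
  fixes V :: "'a set" and E :: "'a set set" and v :: "nat \<Rightarrow> 'a"
    and m d k :: nat and \<omega> :: "nat set \<Rightarrow> int"
  assumes "simple_graph V E"
    and "bij_betw v {1..m} V"
    and "d > 0"
    and "k \<in> {1..m}"
    and "vertex_degree E (v k) = d"
    and "\<And>x. x \<in> V \<Longrightarrow> vertex_degree E x = d \<Longrightarrow> x = v k"
    and "\<And>I. I \<subseteq> {1..m} \<Longrightarrow> (-1) ^ card I * \<omega> I = int (card (cycles_on v E (v k) I))"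
  shows "\<exists>\<mu>. spectrally_simple_eigenvalue (zeon_laplacian m v E) \<mu> \<and>
    \<mu> = of_nat d + (\<Sum>I\<in>Pow {1..m}.
      (of_int (\<omega> I) *
        (\<Prod>j\<in>I - {k}. inverse (of_nat d - of_nat (vertex_degree E (v j))))) *\<^sub>Z zeta I)"
proof -
  interpret unique_degree_vertex V E v m d k
    by unfold_locales (use assms in auto)
  show ?thesis
    using spectrally_simple_eigval eigval_eq[OF assms(7)] by blast
qed

end
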